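(* For every object $\theta$ of $\Theta_2$ there is an integer $d \ge 0$ such that $\theta$ is a retract of the Gray cube $\square^d$ in the category of strict $2$-categories; that is, there exist strict $2$-functors $S : \theta \to \square^d$ and $R : \square^d \to \theta$ with $RS = \mathrm{id}_\theta$.
   Context: $\Theta_2$ is the full subcategory of the category of (small) strict $2$-categories and strict $2$-functors spanned by the $2$-categories $[n;q_1,\dots,q_n]$ ($n\ge 0$, $q_1,\dots,q_n\ge 0$), where $[n;q_1,\dots,q_n]$ is the $2$-category freely generated by the $\mathsf{Cat}$-enriched graph with vertices $0,1,\dots,n$, with hom from $k-1$ to $k$ equal to the poset $[q_k]=\{0<1<\dots<q_k\}$ for $0<k\le n$, and all other homs empty. The Gray cube $\square^d$ is the $d$-fold lax Gray tensor power of the free-living $1$-cell $[1]$ (with $\square^0$ the terminal $2$-category). Explicitly, $\square^d$ is the following poset-enriched category. Objects are binary strings $\epsilon=(\epsilon_1,\dots,\epsilon_d)\in\{0,1\}^d$. If $\epsilon_a\le\zeta_a$ for all $a$, then $\square^d(\epsilon,\zeta)$ is the poset whose elements are the total orders $\preceq$ on the set $\{a : \epsilon_a=0,\ \zeta_a=1\}$, with $\preceq_1$ less than or equal to $\preceq_2$ if and only if for all $a\le b$ with $a\preceq_1 b$ we have $a\preceq_2 b$. Otherwise $\square^d(\epsilon,\zeta)$ is empty. The composite of $\preceq_1\in\square^d(\epsilon,\zeta)$ with $\preceq_2\in\square^d(\zeta,\eta)$ is the join (ordinal sum) of the total orders: all elements ordered by $\preceq_1$ come before all elements ordered by $\preceq_2$.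 *)

theory Defs
  imports Main
begin

section \<open>Categories and functors\<close>

text \<open>All compositions are written in diagrammatic order: \<open>cmp C f g\<close> is \<open>f\<close> followed by \<open>g\<close>.
  Values of the operations outside the carriers are irrelevant.\<close>

record ('o, 'a) cat =
  obj :: "'o set"
  arr :: "'a set"
  src :: "'a \<Rightarrow> 'o"
  tgt :: "'a \<Rightarrow> 'o"
  idn :: "'o \<Rightarrow> 'a"
  cmp :: "'a \<Rightarrow> 'a \<Rightarrow> 'a"

locale category =
  fixes C :: "('o, 'a) cat"
  assumes src_obj: "f \<in> arr C \<Longrightarrow> src C f \<in> obj C"
    and tgt_obj: "f \<in> arr C \<Longrightarrow> tgt C f \<in> obj C"
    and idn_arr: "x \<in> obj C \<Longrightarrow> idn C x \<in> arr C"
    and src_idn: "x \<in> obj C \<Longrightarrow> src C (idn C x) = x"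
    and tgt_idn: "x \<in> obj C \<Longrightarrow> tgt C (idn C x) = x"
    and cmp_arr: "\<lbrakk>f \<in> arr C; g \<in> arr C; tgt C f = src C g\<rbrakk> \<Longrightarrow> cmp C f g \<in> arr C"
    and src_cmp: "\<lbrakk>f \<in> arr C; g \<in> arr C; tgt C f = src C g\<rbrakk> \<Longrightarrow> src C (cmp C f g) = src C f"
    and tgt_cmp: "\<lbrakk>f \<in> arr C; g \<in> arr C; tgt C f = src C g\<rbrakk> \<Longrightarrow> tgt C (cmp C f g) = tgt C g"
    and idn_cmp: "f \<in> arr C \<Longrightarrow> cmp C (idn C (src C f)) f = f"
    and cmp_idn: "f \<in> arr C \<Longrightarrow> cmp C f (idn C (tgt C f)) = f"
    and cmp_assoc: "\<lbrakk>f \<in> arr C; g \<in> arr C; h \<in> arr C; tgt C f = src C g; tgt C g = src C h\<rbrakk>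
        \<Longrightarrow> cmp C (cmp C f g) h = cmp C f (cmp C g h)"

locale cat_functor = A: category A + B: category B
  for A :: "('o, 'a) cat" and B :: "('p, 'b) cat"
    and Fo :: "'o \<Rightarrow> 'p" and Fa :: "'a \<Rightarrow> 'b" +
  assumes map_obj: "x \<in> obj A \<Longrightarrow> Fo x \<in> obj B"
    and map_arr: "f \<in> arr A \<Longrightarrow> Fa f \<in> arr B"
    and map_src: "f \<in> arr A \<Longrightarrow> src B (Fa f) = Fo (src A f)"
    and map_tgt: "f \<in> arr A \<Longrightarrow> tgt B (Fa f) = Fo (tgt A f)"
    and map_idn: "x \<in> obj A \<Longrightarrow> Fa (idn A x) = idn B (Fo x)"
    and map_cmp: "\<lbrakk>f \<in> arr A; g \<in> arr A; tgt A f = src A g\<rbrakk>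
        \<Longrightarrow> Fa (cmp A f g) = cmp B (Fa f) (Fa g)"

definition prod_cat :: "('o, 'a) cat \<Rightarrow> ('p, 'b) cat \<Rightarrow> ('o \<times> 'p, 'a \<times> 'b) cat" where
  "prod_cat A B =
    \<lparr>obj = obj A \<times> obj B,
     arr = arr A \<times> arr B,
     src = map_prod (src A) (src B),
     tgt = map_prod (tgt A) (tgt B),
     idn = map_prod (idn A) (idn B),
     cmp = (\<lambda>(f, g) (f', g'). (cmp A f f', cmp B g g'))\<rparr>"

text \<open>A poset as a category: the unique arrow from \<open>a\<close> to \<open>b\<close> is the pair \<open>(a, b)\<close>.\<close>

definition poset_cat :: "'o set \<Rightarrow> ('o \<Rightarrow> 'o \<Rightarrow> bool) \<Rightarrow> ('o, 'o \<times> 'o) cat" where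
  "poset_cat P le =
    \<lparr>obj = P,
     arr = {(a, b). a \<in> P \<and> b \<in> P \<and> le a b},
     src = fst,
     tgt = snd,
     idn = (\<lambda>a. (a, a)),
     cmp = (\<lambda>(a, _) (_, c). (a, c))\<rparr>"


section \<open>Strict 2-categories and strict 2-functors\<close>

text \<open>A strict 2-category is a category enriched in categories. Horizontal composition is given
  by \<open>hcmp1 K x y z\<close> on 1-cells and \<open>hcmp2 K x y z\<close> on 2-cells, and \<open>unit1 K x\<close> is the identity
  1-cell. Hom-categories for different pairs of 0-cells are not required to be disjoint, which
  is why the operations carry 0-cells as arguments.\<close>

record ('v, 'o, 'a) two_cat =
  cells0 :: "'v set"
  hom :: "'v \<Rightarrow> 'v \<Rightarrow> ('o, 'a) cat"
  unit1 :: "'v \<Rightarrow> 'o"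
  hcmp1 :: "'v \<Rightarrow> 'v \<Rightarrow> 'v \<Rightarrow> 'o \<Rightarrow> 'o \<Rightarrow> 'o"
  hcmp2 :: "'v \<Rightarrow> 'v \<Rightarrow> 'v \<Rightarrow> 'a \<Rightarrow> 'a \<Rightarrow> 'a"

abbreviation cells1 :: "('v, 'o, 'a) two_cat \<Rightarrow> 'v \<Rightarrow> 'v \<Rightarrow> 'o set" where
  "cells1 K x y \<equiv> obj (hom K x y)"

abbreviation cells2 :: "('v, 'o, 'a) two_cat \<Rightarrow> 'v \<Rightarrow> 'v \<Rightarrow> 'a set" where
  "cells2 K x y \<equiv> arr (hom K x y)"

abbreviation unit2 :: "('v, 'o, 'a) two_cat \<Rightarrow> 'v \<Rightarrow> 'a" where
  "unit2 K x \<equiv> idn (hom K x x) (unit1 K x)"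

locale strict_two_category =
  fixes K :: "('v, 'o, 'a) two_cat"
  assumes hom_category: "\<lbrakk>x \<in> cells0 K; y \<in> cells0 K\<rbrakk> \<Longrightarrow> category (hom K x y)"
    and unit1_cell: "x \<in> cells0 K \<Longrightarrow> unit1 K x \<in> cells1 K x x"
    and hcmp_functor: "\<lbrakk>x \<in> cells0 K; y \<in> cells0 K; z \<in> cells0 K\<rbrakk> \<Longrightarrow>
        cat_functor (prod_cat (hom K x y) (hom K y z)) (hom K x z)
          (\<lambda>(f, g). hcmp1 K x y z f g) (\<lambda>(\<alpha>, \<beta>). hcmp2 K x y z \<alpha> \<beta>)"
    and unit1_left: "\<lbrakk>x \<in> cells0 K; y \<in> cells0 K; f \<in> cells1 K x y\<rbrakk>
        \<Longrightarrow> hcmp1 K x x y (unit1 K x) f = f"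
    and unit1_right: "\<lbrakk>x \<in> cells0 K; y \<in> cells0 K; f \<in> cells1 K x y\<rbrakk>
        \<Longrightarrow> hcmp1 K x y y f (unit1 K y) = f"
    and unit2_left: "\<lbrakk>x \<in> cells0 K; y \<in> cells0 K; \<alpha> \<in> cells2 K x y\<rbrakk>
        \<Longrightarrow> hcmp2 K x x y (unit2 K x) \<alpha> = \<alpha>"
    and unit2_right: "\<lbrakk>x \<in> cells0 K; y \<in> cells0 K; \<alpha> \<in> cells2 K x y\<rbrakk>
        \<Longrightarrow> hcmp2 K x y y \<alpha> (unit2 K y) = \<alpha>"
    and hcmp1_assoc: "\<lbrakk>w \<in> cells0 K; x \<in> cells0 K; y \<in> cells0 K; z \<in> cells0 K;
          f \<in> cells1 K w x; g \<in> cells1 K x y; h \<in> cells1 K y z\<rbrakk>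
        \<Longrightarrow> hcmp1 K w y z (hcmp1 K w x y f g) h = hcmp1 K w x z f (hcmp1 K x y z g h)"
    and hcmp2_assoc: "\<lbrakk>w \<in> cells0 K; x \<in> cells0 K; y \<in> cells0 K; z \<in> cells0 K;
          \<alpha> \<in> cells2 K w x; \<beta> \<in> cells2 K x y; \<gamma> \<in> cells2 K y z\<rbrakk>
        \<Longrightarrow> hcmp2 K w y z (hcmp2 K w x y \<alpha> \<beta>) \<gamma> = hcmp2 K w x z \<alpha> (hcmp2 K x y z \<beta> \<gamma>)"

record ('v, 'o, 'a, 'w, 'p, 'b) two_map =
  map0 :: "'v \<Rightarrow> 'w"
  map1 :: "'v \<Rightarrow> 'v \<Rightarrow> 'o \<Rightarrow> 'p"
  map2 :: "'v \<Rightarrow> 'v \<Rightarrow> 'a \<Rightarrow> 'b"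

locale strict_two_functor = K: strict_two_category K + L: strict_two_category L
  for K :: "('v, 'o, 'a) two_cat" and L :: "('w, 'p, 'b) two_cat"
    and F :: "('v, 'o, 'a, 'w, 'p, 'b) two_map" +
  assumes map0_cell: "x \<in> cells0 K \<Longrightarrow> map0 F x \<in> cells0 L"
    and hom_functor: "\<lbrakk>x \<in> cells0 K; y \<in> cells0 K\<rbrakk> \<Longrightarrow>
        cat_functor (hom K x y) (hom L (map0 F x) (map0 F y)) (map1 F x y) (map2 F x y)"
    and map1_unit1: "x \<in> cells0 K \<Longrightarrow> map1 F x x (unit1 K x) = unit1 L (map0 F x)"
    and map1_hcmp1: "\<lbrakk>x \<in> cells0 K; y \<in> cells0 K; z \<in> cells0 K;
          f \<in> cells1 K x y; g \<in> cells1 K y z\<rbrakk> \<Longrightarrow>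
        map1 F x z (hcmp1 K x y z f g)
          = hcmp1 L (map0 F x) (map0 F y) (map0 F z) (map1 F x y f) (map1 F y z g)"
    and map2_hcmp2: "\<lbrakk>x \<in> cells0 K; y \<in> cells0 K; z \<in> cells0 K;
          \<alpha> \<in> cells2 K x y; \<beta> \<in> cells2 K y z\<rbrakk> \<Longrightarrow>
        map2 F x z (hcmp2 K x y z \<alpha> \<beta>)
          = hcmp2 L (map0 F x) (map0 F y) (map0 F z) (map2 F x y \<alpha>) (map2 F y z \<beta>)"

definition id_two_map :: "('v, 'o, 'a, 'v, 'o, 'a) two_map" where
  "id_two_map = \<lparr>map0 = (\<lambda>x. x), map1 = (\<lambda>x y f. f), map2 = (\<lambda>x y \<alpha>. \<alpha>)\<rparr>"

text \<open>\<open>comp_two_map G F\<close> is \<open>G \<circ> F\<close>.\<close>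

definition comp_two_map ::
  "('w, 'p, 'b, 'u, 'q, 'c) two_map \<Rightarrow> ('v, 'o, 'a, 'w, 'p, 'b) two_map
    \<Rightarrow> ('v, 'o, 'a, 'u, 'q, 'c) two_map" where
  "comp_two_map G F =
    \<lparr>map0 = (\<lambda>x. map0 G (map0 F x)),
     map1 = (\<lambda>x y f. map1 G (map0 F x) (map0 F y) (map1 F x y f)),
     map2 = (\<lambda>x y \<alpha>. map2 G (map0 F x) (map0 F y) (map2 F x y \<alpha>))\<rparr>"

text \<open>Equality of 2-functors with domain \<open>K\<close>: agreement on all cells of \<open>K\<close>, since the underlying
  HOL functions have junk values elsewhere.\<close>

definition two_map_eq_on :: "('v, 'o, 'a) two_cat \<Rightarrow> ('v, 'o, 'a, 'w, 'p, 'b) two_map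
    \<Rightarrow> ('v, 'o, 'a, 'w, 'p, 'b) two_map \<Rightarrow> bool" where
  "two_map_eq_on K F G \<longleftrightarrow>
    (\<forall>x\<in>cells0 K. map0 F x = map0 G x) \<and>
    (\<forall>x\<in>cells0 K. \<forall>y\<in>cells0 K.
      (\<forall>f\<in>cells1 K x y. map1 F x y f = map1 G x y f) \<and>
      (\<forall>\<alpha>\<in>cells2 K x y. map2 F x y \<alpha> = map2 G x y \<alpha>))"


section \<open>The free strict 2-category on a Cat-enriched graph\<close>

record ('v, 'o, 'a) cat_graph =
  verts :: "'v set"
  edges :: "'v \<Rightarrow> 'v \<Rightarrow> ('o, 'a) cat"

text \<open>\<open>is_path V L x p y\<close>: the list \<open>p\<close> of labelled steps is a path from \<open>x\<close> to \<open>y\<close> through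
  vertices in \<open>V\<close>, a step \<open>(u, v, l)\<close> going from \<open>u\<close> to \<open>v\<close> with label \<open>l \<in> L u v\<close>.\<close>

fun is_path :: "'v set \<Rightarrow> ('v \<Rightarrow> 'v \<Rightarrow> 'l set) \<Rightarrow> 'v \<Rightarrow> ('v \<times> 'v \<times> 'l) list \<Rightarrow> 'v \<Rightarrow> bool" where
  "is_path V L x [] y \<longleftrightarrow> x \<in> V \<and> x = y"
| "is_path V L x ((u, v, l) # p) y \<longleftrightarrow> u = x \<and> x \<in> V \<and> l \<in> L u v \<and> is_path V L v p y"

definition map_labels :: "('v \<Rightarrow> 'v \<Rightarrow> 'l \<Rightarrow> 'm) \<Rightarrow> ('v \<times> 'v \<times> 'l) list \<Rightarrow> ('v \<times> 'v \<times> 'm) list" where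
  "map_labels h = map (\<lambda>(u, v, l). (u, v, h u v l))"

text \<open>The hom-category from \<open>x\<close> to \<open>y\<close> is the coproduct, over all sequences of vertices
  \<open>x = v\<^sub>0, \<dots>, v\<^sub>m = y\<close>, of the products of the categories \<open>edges G v\<^sub>i v\<^sub>i\<^sub>+\<^sub>1\<close>: a 1-cell is a path
  labelled by objects, a 2-cell is a path labelled by arrows, and the vertical structure is
  computed label by label. Horizontal composition is concatenation of paths.\<close>

definition free_two_cat ::
  "('v, 'o, 'a) cat_graph \<Rightarrow> ('v, ('v \<times> 'v \<times> 'o) list, ('v \<times> 'v \<times> 'a) list) two_cat" where
  "free_two_cat G =
    \<lparr>cells0 = verts G,
     hom = (\<lambda>x y.
       \<lparr>obj = {p. is_path (verts G) (\<lambda>u v. obj (edges G u v)) x p y},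
        arr = {p. is_path (verts G) (\<lambda>u v. arr (edges G u v)) x p y},
        src = map_labels (\<lambda>u v. src (edges G u v)),
        tgt = map_labels (\<lambda>u v. tgt (edges G u v)),
        idn = map_labels (\<lambda>u v. idn (edges G u v)),
        cmp = List.map2 (\<lambda>(u, v, \<alpha>) (_, _, \<beta>). (u, v, cmp (edges G u v) \<alpha> \<beta>))\<rparr>),
     unit1 = (\<lambda>x. []),
     hcmp1 = (\<lambda>x y z p q. p @ q),
     hcmp2 = (\<lambda>x y z p q. p @ q)\<rparr>"


section \<open>The objects of \<open>\<Theta>\<^sub>2\<close>\<close>

text \<open>\<open>theta n q\<close> is \<open>[n; q 1, \<dots>, q n]\<close>; other values of \<open>q\<close> play no role.\<close>

definition theta_graph :: "nat \<Rightarrow> (nat \<Rightarrow> nat) \<Rightarrow> (nat, nat, nat \<times> nat) cat_graph" where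
  "theta_graph n q =
    \<lparr>verts = {0..n},
     edges = (\<lambda>u v. if v = u + 1 \<and> v \<le> n then poset_cat {0..q v} (\<le>) else poset_cat {} (\<le>))\<rparr>"

definition theta :: "nat \<Rightarrow> (nat \<Rightarrow> nat) \<Rightarrow>
    (nat, (nat \<times> nat \<times> nat) list, (nat \<times> nat \<times> nat \<times> nat) list) two_cat" where
  "theta n q = free_two_cat (theta_graph n q)"

definition Theta2_objects ::
    "(nat, (nat \<times> nat \<times> nat) list, (nat \<times> nat \<times> nat \<times> nat) list) two_cat set" where
  "Theta2_objects = {theta n q | n q. True}"


section \<open>Gray cubes\<close>

text \<open>Binary strings of length \<open>d\<close> are Boolean lists, with positions numbered from \<open>0\<close>.\<close>

definition flips :: "bool list \<Rightarrow> bool list \<Rightarrow> nat set" where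
  "flips e z = {a. a < length e \<and> \<not> e ! a \<and> z ! a}"

text \<open>Total orders are reflexive relations; \<open>(a, b) \<in> r\<close> means that \<open>a\<close> comes before \<open>b\<close>.\<close>

definition shuffle_le :: "nat rel \<Rightarrow> nat rel \<Rightarrow> bool" where
  "shuffle_le r s \<longleftrightarrow> (\<forall>a b. a \<le> b \<and> (a, b) \<in> r \<longrightarrow> (a, b) \<in> s)"

definition ordinal_sum :: "nat rel \<Rightarrow> nat rel \<Rightarrow> nat rel" where
  "ordinal_sum r s = r \<union> s \<union> Field r \<times> Field s"

definition gray_cube :: "nat \<Rightarrow> (bool list, nat rel, nat rel \<times> nat rel) two_cat" where
  "gray_cube d =
    \<lparr>cells0 = {e. length e = d},
     hom = (\<lambda>e z. poset_cat
       (if \<forall>a<d. e ! a \<le> z ! a then {r. linear_order_on (flips e z) r} else {}) shuffle_le),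
     unit1 = (\<lambda>e. {}),
     hcmp1 = (\<lambda>e z h. ordinal_sum),
     hcmp2 = (\<lambda>e z h (r, r') (s, s'). (ordinal_sum r s, ordinal_sum r' s'))\<rparr>"

end

theory Submission
  imports Defs
begin

text \<open>Take \<open>n\<close> consecutive blocks of \<open>N\<close> coordinates each, with \<open>N\<close> larger than every \<open>q\<^sub>k\<close>.
  The section sends the object \<open>x\<close> to the string whose ones fill the first \<open>x\<close> blocks, and the
  label \<open>l\<close> of an edge to the order on its block that reverses an initial segment of the block and
  whose first element lies \<open>q\<^sub>k - l\<close> places after the start of the block; shortening the reversed
  segment moves up in the shuffle order. The retraction sends a string to the number of the last
  block containing a one, and an order of flips to the path whose \<open>k\<close>-th label depends only on the
  first flip in or beyond block \<open>k\<close>: it decreases from \<open>q\<^sub>k\<close> with the position of that flip in the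
  block, and is \<open>0\<close> if the block is skipped. It is monotone because that first flip can only move
  to the left when going up in the shuffle order.\<close>

section \<open>Product categories and posets\<close>

lemma category_prod_cat:
  assumes "category A" "category B"
  shows "category (prod_cat A B)"
proof -
  interpret A: category A by fact
  interpret B: category B by fact
  show ?thesis
    by unfold_locales
      (auto simp: prod_cat_def A.src_obj A.tgt_obj A.idn_arr A.src_idn A.tgt_idn A.cmp_arr
        A.src_cmp A.tgt_cmp A.idn_cmp A.cmp_idn A.cmp_assoc B.src_obj B.tgt_obj B.idn_arr
        B.src_idn B.tgt_idn B.cmp_arr B.src_cmp B.tgt_cmp B.idn_cmp B.cmp_idn B.cmp_assoc)
qed

lemma category_poset_cat:
  assumes "\<And>a. a \<in> P \<Longrightarrow> le a a"
    and "\<And>a b c. \<lbrakk>a \<in> P; b \<in> P; c \<in> P; le a b; le b c\<rbrakk> \<Longrightarrow> le a c"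
  shows "category (poset_cat P le)"
  by unfold_locales (auto simp: poset_cat_def assms(1) intro: assms(2))

text \<open>A poset has at most one arrow between two objects, so once \<open>Fa\<close> returns the
  pair of endpoints, identities and composites are preserved for free; membership and monotonicity
  are what is left.\<close>

lemma cat_functor_poset_catI:
  assumes "category C" "category (poset_cat P le)"
    and obj: "\<And>x. x \<in> obj C \<Longrightarrow> Fo x \<in> P"
    and le: "\<And>f. f \<in> arr C \<Longrightarrow> le (Fo (src C f)) (Fo (tgt C f))"
    and Fa: "\<And>f. Fa f = (Fo (src C f), Fo (tgt C f))"
  shows "cat_functor C (poset_cat P le) Fo Fa"
proof -
  interpret C: category C by fact
  interpret P: category "poset_cat P le" by fact
  show ?thesis
    by unfold_locales
      (auto simp: poset_cat_def Fa C.src_idn C.tgt_idn C.src_cmp C.tgt_cmp C.src_obj C.tgt_obj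
        intro: obj le)
qed

section \<open>Free strict 2-categories\<close>

lemma is_path_ends: "is_path V L x p y \<Longrightarrow> x \<in> V \<and> y \<in> V"
  by (induction V L x p y rule: is_path.induct) auto

lemma is_path_append:
  "is_path V L x p y \<Longrightarrow> is_path V L y q z \<Longrightarrow> is_path V L x (p @ q) z"
  by (induction V L x p y rule: is_path.induct) auto

section \<open>Relabelling of paths\<close>

lemma map_labels_simps [simp]:
  "map_labels h [] = []"
  "map_labels h p = [] \<longleftrightarrow> p = []"
  "[] = map_labels h p \<longleftrightarrow> p = []"
  "map_labels h ((u, v, l) # p) = (u, v, h u v l) # map_labels h p"
  "map_labels h (p @ q) = map_labels h p @ map_labels h q"
  by (simp_all add: map_labels_def)

lemma is_path_map_labels:
  assumes "is_path V L x p y"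
    and "\<And>u v l. \<lbrakk>u \<in> V; v \<in> V; l \<in> L u v\<rbrakk> \<Longrightarrow> h u v l \<in> M u v"
  shows "is_path V M x (map_labels h p) y"
  using assms
  by (induction V L x p y rule: is_path.induct) (auto dest: is_path_ends)

lemma map_labels_cong_path:
  assumes "is_path V L x p y"
    and "\<And>u v l. \<lbrakk>u \<in> V; v \<in> V; l \<in> L u v\<rbrakk> \<Longrightarrow> h u v l = g u v l"
  shows "map_labels h p = map_labels g p"
  using assms
  by (induction V L x p y rule: is_path.induct) (auto dest: is_path_ends)

lemma map_labels_ident: "map_labels (\<lambda>u v l. l) p = p"
  by (simp add: map_labels_def split_beta')

lemma map_labels_comp:
  "map_labels h (map_labels g p) = map_labels (\<lambda>u v l. h u v (g u v l)) p"
  by (auto simp: map_labels_def)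

text \<open>Vertically composable 2-cells thus have equal length, so \<open>zip\<close> distributes
  over concatenation; this gives the interchange law.\<close>

lemma map_labels_eq_length: "map_labels h p = map_labels g q \<Longrightarrow> length p = length q"
  by (auto simp: map_labels_def dest: map_eq_imp_length_eq)

text \<open>Each law holds label by label. The inductions leave the start vertex arbitrary because
  the tail of a path starts elsewhere.\<close>

lemma category_free_hom:
  fixes G :: "('v, 'o, 'a) cat_graph"
  assumes "\<And>u v. \<lbrakk>u \<in> verts G; v \<in> verts G\<rbrakk> \<Longrightarrow> category (edges G u v)"
  shows "category (hom (free_two_cat G) x y)"
proof -
  let ?V = "verts G"
  let ?O = "\<lambda>u v. obj (edges G u v)"
  let ?A = "\<lambda>u v. arr (edges G u v)"
  let ?s = "map_labels (\<lambda>u v. src (edges G u v))"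
  let ?t = "map_labels (\<lambda>u v. tgt (edges G u v))"
  let ?i = "map_labels (\<lambda>u v. idn (edges G u v))"
  let ?c = "List.map2 (\<lambda>(u, v, \<alpha>) (_, _, \<beta>). (u, v, cmp (edges G u v) \<alpha> \<beta>))"
  note C = category.src_obj[OF assms] category.tgt_obj[OF assms] category.idn_arr[OF assms]
    category.src_idn[OF assms] category.tgt_idn[OF assms] category.cmp_arr[OF assms]
    category.src_cmp[OF assms] category.tgt_cmp[OF assms] category.idn_cmp[OF assms]
    category.cmp_idn[OF assms] category.cmp_assoc[OF assms]
  have cmp: "is_path ?V ?A x (?c p q) y \<and> ?s (?c p q) = ?s p \<and> ?t (?c p q) = ?t q"
    if "is_path ?V ?A x p y" "is_path ?V ?A x q y" "?t p = ?s q" for x p q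
    using that
  proof (induction p arbitrary: x q)
    case (Cons a p)
    moreover obtain u v l where "a = (u, v, l)"
      by (cases a)
    \<comment> \<open>\<open>is_path\<close> tests only the source of a step for membership in
      \<open>?V\<close>; for its target this follows from the rest of the path, and
      \<open>assms\<close> needs both.\<close>
    moreover from calculation have "v \<in> ?V"
      by (auto dest: is_path_ends)
    ultimately show ?case
      by (cases q) (auto simp: C)
  qed auto
  have idn_cmp: "?c (?i (?s p)) p = p" if "is_path ?V ?A x p y" for x p
    using that
  proof (induction p arbitrary: x)
    case (Cons a p)
    moreover obtain u v l where "a = (u, v, l)"
      by (cases a)
    moreover from calculation have "v \<in> ?V"
      by (auto dest: is_path_ends)
    ultimately show ?case
      by (auto simp: C)
  qed auto
  have cmp_idn: "?c p (?i (?t p)) = p" if "is_path ?V ?A x p y" for x p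
    using that
  proof (induction p arbitrary: x)
    case (Cons a p)
    moreover obtain u v l where "a = (u, v, l)"
      by (cases a)
    moreover from calculation have "v \<in> ?V"
      by (auto dest: is_path_ends)
    ultimately show ?case
      by (auto simp: C)
  qed auto
  have assoc: "?c (?c p q) r = ?c p (?c q r)"
    if "is_path ?V ?A x p y" "is_path ?V ?A x q y" "is_path ?V ?A x r y"
      "?t p = ?s q" "?t q = ?s r" for x p q r
    using that
  proof (induction p arbitrary: x q r)
    case (Cons a p)
    moreover obtain u v l where "a = (u, v, l)"
      by (cases a)
    moreover from calculation have "v \<in> ?V"
      by (auto dest: is_path_ends)
    ultimately show ?case
      by (cases q; cases r) (auto simp: C)
  qed auto
  have id: "?s (?i p) = p" "?t (?i p) = p" if "is_path ?V ?O x p y" for x p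
    using map_labels_cong_path[OF that, of _ "\<lambda>u v l. l"]
    by (simp_all add: map_labels_comp map_labels_ident C)
  show ?thesis
    by unfold_locales
      (use cmp idn_cmp cmp_idn assoc id in
        \<open>auto simp: free_two_cat_def C intro: is_path_map_labels\<close>)
qed

lemma strict_two_category_free_two_cat:
  fixes G :: "('v, 'o, 'a) cat_graph"
  assumes "\<And>u v. \<lbrakk>u \<in> verts G; v \<in> verts G\<rbrakk> \<Longrightarrow> category (edges G u v)"
  shows "strict_two_category (free_two_cat G)"
proof (rule strict_two_category.intro)
  note hom_cat = category_free_hom[OF assms]
  show "cat_functor (prod_cat (hom (free_two_cat G) x y) (hom (free_two_cat G) y z))
      (hom (free_two_cat G) x z)
      (\<lambda>(f, g). hcmp1 (free_two_cat G) x y z f g) (\<lambda>(\<alpha>, \<beta>). hcmp2 (free_two_cat G) x y z \<alpha> \<beta>)"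
    for x y z
    unfolding cat_functor_def cat_functor_axioms_def
    by (intro conjI category_prod_cat hom_cat)
      (auto simp: free_two_cat_def prod_cat_def intro: is_path_append dest: map_labels_eq_length)
qed (auto simp: category_free_hom[OF assms], auto simp: free_two_cat_def)

section \<open>Ordinal sums and Gray cubes\<close>

lemma Field_ordinal_sum [simp]: "Field (ordinal_sum r s) = Field r \<union> Field s"
  by (auto simp: ordinal_sum_def Field_def)

lemma ordinal_sum_assoc: "ordinal_sum (ordinal_sum r s) t = ordinal_sum r (ordinal_sum s t)"
  \<comment> \<open>Only the outer sums are unfolded at first, so that the fields of the inner ones
    can be rewritten as unions.\<close>
  unfolding ordinal_sum_def[of "ordinal_sum r s"] ordinal_sum_def[of r "ordinal_sum s t"]
    Field_ordinal_sum
  by (auto simp: ordinal_sum_def)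

lemma ordinal_sum_empty [simp]: "ordinal_sum {} r = r" "ordinal_sum r {} = r"
  by (auto simp: ordinal_sum_def)

lemma Field_linear_order: "linear_order_on A r \<Longrightarrow> Field r = A"
  by (auto simp: order_on_defs Field_def refl_on_def)

lemma linear_order_on_ordinal_sum:
  assumes "linear_order_on A r" "linear_order_on B s" "A \<inter> B = {}"
  shows "linear_order_on (A \<union> B) (ordinal_sum r s)"
proof -
  have F: "Field r = A" "Field s = B"
    using assms by (auto dest: Field_linear_order)
  have sub: "r \<subseteq> A \<times> A" "s \<subseteq> B \<times> B" and tr: "trans r" "trans s"
    and an: "antisym r" "antisym s"
    using assms by (auto simp: order_on_defs)
  have "trans (ordinal_sum r s)"
    unfolding ordinal_sum_def F
    by (rule transI) (use sub assms(3) in \<open>auto dest: transD[OF tr(1)] transD[OF tr(2)]\<close>)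
  moreover have "antisym (ordinal_sum r s)"
    unfolding ordinal_sum_def F
    by (rule antisymI) (use sub assms(3) in \<open>auto dest: antisymD[OF an(1)] antisymD[OF an(2)]\<close>)
  ultimately show ?thesis
    using assms(1,2) by (auto simp: order_on_defs ordinal_sum_def F refl_on_def total_on_def)
qed

lemma shuffle_le_refl: "shuffle_le r r"
  by (simp add: shuffle_le_def)

text \<open>The cross pairs of a sum depend only on the two fields, and these agree.\<close>

lemma shuffle_le_ordinal_sum:
  assumes "shuffle_le r r'" "shuffle_le s s'" "Field r = Field r'" "Field s = Field s'"
  shows "shuffle_le (ordinal_sum r s) (ordinal_sum r' s')"
  using assms by (auto simp: shuffle_le_def ordinal_sum_def)

section \<open>Hom posets of the Gray cube\<close>

definition gray_cells :: "nat \<Rightarrow> bool list \<Rightarrow> bool list \<Rightarrow> nat rel set" where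
  "gray_cells d e z = (if \<forall>a<d. e ! a \<le> z ! a then {r. linear_order_on (flips e z) r} else {})"

lemma gray_cube_hom:
  "hom (gray_cube d) e z = poset_cat (gray_cells d e z) shuffle_le"
  by (simp add: gray_cube_def gray_cells_def)

lemma gray_cube_simps [simp]:
  "cells0 (gray_cube d) = {e. length e = d}"
  "unit1 (gray_cube d) e = {}"
  "hcmp1 (gray_cube d) e z h = ordinal_sum"
  "hcmp2 (gray_cube d) e z h = (\<lambda>(r, r') (s, s'). (ordinal_sum r s, ordinal_sum r' s'))"
  by (simp_all add: gray_cube_def)

lemma Field_gray_cells: "r \<in> gray_cells d e z \<Longrightarrow> Field r = flips e z"
  by (auto simp: gray_cells_def Field_linear_order split: if_splits)

text \<open>Coordinates only go up, so each flip from \<open>e\<close> to \<open>h\<close> happens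
  either before or after \<open>z\<close> and never twice.\<close>

lemma ordinal_sum_gray_cells:
  assumes "length e = d" "length z = d" "r \<in> gray_cells d e z" "s \<in> gray_cells d z h"
  shows "ordinal_sum r s \<in> gray_cells d e h"
proof -
  have ez: "e ! a \<Longrightarrow> z ! a" and zh: "z ! a \<Longrightarrow> h ! a" if "a < d" for a
    using assms that by (auto simp: gray_cells_def split: if_splits)
  have "flips e h = flips e z \<union> flips z h" "flips e z \<inter> flips z h = {}"
    using assms(1,2) ez zh by (auto simp: flips_def)
  then show ?thesis
    using assms ez zh linear_order_on_ordinal_sum[of "flips e z" r "flips z h" s]
    by (auto simp: gray_cells_def split: if_splits)
qed

lemma category_gray_cells: "category (poset_cat (gray_cells d e z) shuffle_le)"
  by (rule category_poset_cat) (auto simp: shuffle_le_def)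

lemma strict_two_category_gray_cube: "strict_two_category (gray_cube d)"
proof (rule strict_two_category.intro)
  fix x y z :: "bool list"
  assume "x \<in> cells0 (gray_cube d)" "y \<in> cells0 (gray_cube d)" "z \<in> cells0 (gray_cube d)"
  then show "cat_functor (prod_cat (hom (gray_cube d) x y) (hom (gray_cube d) y z))
      (hom (gray_cube d) x z) (\<lambda>(f, g). hcmp1 (gray_cube d) x y z f g)
      (\<lambda>(\<alpha>, \<beta>). hcmp2 (gray_cube d) x y z \<alpha> \<beta>)"
    unfolding gray_cube_hom
    by (intro cat_functor_poset_catI category_prod_cat category_gray_cells)
      (auto simp: prod_cat_def poset_cat_def Field_gray_cells
        intro: ordinal_sum_gray_cells intro!: shuffle_le_ordinal_sum)
qed (auto simp: gray_cube_hom category_gray_cells ordinal_sum_assoc,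
    auto simp: poset_cat_def gray_cells_def flips_def)

section \<open>First elements of linear orders\<close>

text \<open>Two orders are in play: \<open>m\<close> cuts off coordinates by numerical position,
  while first means earliest in \<open>r\<close>.\<close>

definition is_first :: "nat \<Rightarrow> nat rel \<Rightarrow> nat \<Rightarrow> bool" where
  "is_first m r a \<longleftrightarrow> a \<in> Field r \<and> m \<le> a \<and> (\<forall>b\<in>Field r. m \<le> b \<longrightarrow> (a, b) \<in> r)"

definition first_from :: "nat \<Rightarrow> nat rel \<Rightarrow> nat" where
  "first_from m r = (THE a. is_first m r a)"

lemma first_from_eq:
  assumes "antisym r" "is_first m r a"
  shows "first_from m r = a"
  unfolding first_from_def
  by (rule the_equality) (use assms in \<open>auto simp: is_first_def dest: antisymD\<close>)

lemma linear_order_has_least: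
  assumes "finite B" "B \<noteq> {}" "B \<subseteq> A" "linear_order_on A r"
  shows "\<exists>a\<in>B. \<forall>b\<in>B. (a, b) \<in> r"
  using assms
proof (induction B rule: finite_ne_induct)
  case (singleton x)
  then show ?case by (auto simp: order_on_defs refl_on_def)
next
  case (insert x F)
  then obtain a where a: "a \<in> F" "\<forall>b\<in>F. (a, b) \<in> r" by auto
  have "(x, x) \<in> r" "(x, a) \<in> r \<or> (a, x) \<in> r" "trans r"
    using insert a by (auto simp: order_on_defs refl_on_def total_on_def)
  with a show ?case by (auto dest: transD)
qed

lemma is_first_first_from:
  assumes "linear_order_on A r" "finite A" "b \<in> A" "m \<le> b"
  shows "is_first m r (first_from m r)"
proof -
  have "\<exists>a\<in>{c\<in>A. m \<le> c}. \<forall>b\<in>{c\<in>A. m \<le> c}. (a, b) \<in> r"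
    by (rule linear_order_has_least[OF _ _ _ assms(1)]) (use assms in auto)
  then obtain a where "is_first m r a"
    using Field_linear_order[OF assms(1)] by (auto simp: is_first_def)
  moreover have "antisym r"
    using assms by (auto simp: order_on_defs)
  ultimately show ?thesis using first_from_eq by metis
qed

text \<open>Let \<open>a\<close> and \<open>b\<close> be the first elements for \<open>r\<close> and
  \<open>s\<close>. If \<open>a < b\<close>, then \<open>shuffle_le\<close> carries the pair
  \<open>(a, b)\<close> from \<open>r\<close> over to \<open>s\<close>, where \<open>b\<close>
  already precedes \<open>a\<close>.\<close>

lemma first_from_anti_mono:
  assumes "linear_order_on A r" "linear_order_on A s" "finite A" "b \<in> A" "m \<le> b" "shuffle_le r s"
  shows "first_from m s \<le> first_from m r"
proof (rule ccontr)
  assume less: "\<not> first_from m s \<le> first_from m r"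
  note first = is_first_first_from[OF assms(1,3-5)] is_first_first_from[OF assms(2,3-5)]
  have "Field r = A" "Field s = A"
    using assms by (auto simp: Field_linear_order)
  then have "(first_from m r, first_from m s) \<in> r" "(first_from m s, first_from m r) \<in> s"
    using first by (auto simp: is_first_def)
  moreover from this(1) have "(first_from m r, first_from m s) \<in> s"
    using assms(6) less by (auto simp: shuffle_le_def)
  moreover have "antisym s"
    using assms by (auto simp: order_on_defs)
  ultimately show False
    using less by (auto dest: antisymD)
qed

text \<open>All of \<open>A\<close> precedes all of \<open>B\<close>, so \<open>B\<close> is
  consulted only when \<open>A\<close> has nothing from \<open>m\<close> on.\<close>

lemma first_from_ordinal_sum:
  assumes "linear_order_on A r" "linear_order_on B s" "A \<inter> B = {}" "finite A" "finite B"
    "b \<in> A \<union> B" "m \<le> b"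
  shows "first_from m (ordinal_sum r s) =
    (if \<exists>a\<in>A. m \<le> a then first_from m r else first_from m s)"
proof (rule first_from_eq)
  show "antisym (ordinal_sum r s)"
    using linear_order_on_ordinal_sum[OF assms(1-3)] by (auto simp: order_on_defs)
  have F: "Field r = A" "Field s = B"
    using assms by (auto dest: Field_linear_order)
  show "is_first m (ordinal_sum r s)
    (if \<exists>a\<in>A. m \<le> a then first_from m r else first_from m s)"
  proof (cases "\<exists>a\<in>A. m \<le> a")
    case True
    then have "is_first m r (first_from m r)"
      using is_first_first_from assms by blast
    with True show ?thesis
      unfolding is_first_def Field_ordinal_sum by (auto simp: ordinal_sum_def F)
  next
    case False
    then have "is_first m s (first_from m s)"
      using is_first_first_from assms by blast
    with False show ?thesis
      unfolding is_first_def Field_ordinal_sum by (auto simp: ordinal_sum_def F)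
  qed
qed

section \<open>Linear orders that reverse an initial segment\<close>

definition flip_order :: "nat set \<Rightarrow> nat \<Rightarrow> nat rel" where
  "flip_order A f = {(a, b). a \<in> A \<and> b \<in> A \<and> (if a \<le> f \<and> b \<le> f then b \<le> a else a \<le> b)}"

lemma linear_order_on_flip_order: "linear_order_on A (flip_order A f)"
  by (auto simp: order_on_defs refl_on_def trans_def antisym_def total_on_def flip_order_def
      split: if_splits)

text \<open>The reversed segment starts with its largest element \<open>f\<close>; this is how the
  retraction reads a label back.\<close>

lemma first_from_flip_order:
  assumes "f \<in> A" "m \<le> f"
  shows "first_from m (flip_order A f) = f"
proof (rule first_from_eq)
  show "antisym (flip_order A f)"
    using linear_order_on_flip_order[of A f] by (auto simp: order_on_defs)
  show "is_first m (flip_order A f) f"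
    unfolding is_first_def Field_linear_order[OF linear_order_on_flip_order]
    using assms by (auto simp: flip_order_def)
qed

text \<open>A pair \<open>a < b\<close> is inverted exactly when \<open>b\<close> is at most the
  parameter, so a smaller parameter inverts fewer pairs.\<close>

lemma shuffle_le_flip_order: "g \<le> f \<Longrightarrow> shuffle_le (flip_order A f) (flip_order A g)"
  by (auto simp: shuffle_le_def flip_order_def)

section \<open>The 2-categories \<open>[n; q\<^sub>1, \<dots>, q\<^sub>n]\<close>\<close>

lemma theta_graph_simps:
  "verts (theta_graph n q) = {0..n}"
  "obj (edges (theta_graph n q) u v) = {l. v = Suc u \<and> v \<le> n \<and> l \<le> q v}"
  "arr (edges (theta_graph n q) u v) = {(l, m). v = Suc u \<and> v \<le> n \<and> l \<le> m \<and> m \<le> q v}"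
  "src (edges (theta_graph n q) u v) = fst"
  "tgt (edges (theta_graph n q) u v) = snd"
  "idn (edges (theta_graph n q) u v) = (\<lambda>a. (a, a))"
  "cmp (edges (theta_graph n q) u v) = (\<lambda>(a, _) (_, c). (a, c))"
  by (auto simp: theta_graph_def poset_cat_def)

text \<open>A named label family keeps \<open>is_path\<close> goals folded; the conditions on a
  label enter through \<open>in_theta_obj_iff\<close>.\<close>

definition theta_obj :: "nat \<Rightarrow> (nat \<Rightarrow> nat) \<Rightarrow> nat \<Rightarrow> nat \<Rightarrow> nat set" where
  "theta_obj n q u v = {l. v = Suc u \<and> v \<le> n \<and> l \<le> q v}"

definition theta_arr :: "nat \<Rightarrow> (nat \<Rightarrow> nat) \<Rightarrow> nat \<Rightarrow> nat \<Rightarrow> (nat \<times> nat) set" where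
  "theta_arr n q u v = {(l, m). v = Suc u \<and> v \<le> n \<and> l \<le> m \<and> m \<le> q v}"

lemma in_theta_obj_iff: "l \<in> theta_obj n q u v \<longleftrightarrow> v = Suc u \<and> v \<le> n \<and> l \<le> q v"
  by (simp add: theta_obj_def)

lemma in_theta_arr_iff:
  "t \<in> theta_arr n q u v \<longleftrightarrow> v = Suc u \<and> v \<le> n \<and> fst t \<le> snd t \<and> snd t \<le> q v"
  by (cases t) (simp add: theta_arr_def)

lemma theta_simps [simp]:
  "cells0 (theta n q) = {0..n}"
  "obj (hom (theta n q) x y) = {p. is_path {0..n} (theta_obj n q) x p y}"
  "arr (hom (theta n q) x y) = {p. is_path {0..n} (theta_arr n q) x p y}"
  "src (hom (theta n q) x y) = map_labels (\<lambda>_ _. fst)"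
  "tgt (hom (theta n q) x y) = map_labels (\<lambda>_ _. snd)"
  "idn (hom (theta n q) x y) = map_labels (\<lambda>_ _ a. (a, a))"
  "cmp (hom (theta n q) x y) =
    List.map2 (\<lambda>(u, v, \<alpha>) (_, _, \<beta>). (u, v, (\<lambda>(a, _) (_, c). (a, c)) \<alpha> \<beta>))"
  "unit1 (theta n q) x = []"
  "hcmp1 (theta n q) x y z p p' = p @ p'"
  "hcmp2 (theta n q) x y z t t' = t @ t'"
  by (simp_all add: theta_def free_two_cat_def theta_graph_simps theta_obj_def[abs_def]
      theta_arr_def[abs_def])

lemma strict_two_category_theta: "strict_two_category (theta n q)"
  unfolding theta_def
  by (rule strict_two_category_free_two_cat)
    (auto simp: theta_graph_def intro!: category_poset_cat)

lemma is_path_upt: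
  assumes "x \<le> y" "y \<le> n" "\<And>k. x \<le> k \<Longrightarrow> k < y \<Longrightarrow> l k \<in> L k (Suc k)"
  shows "is_path {0..n} L x (map (\<lambda>k. (k, Suc k, l k)) [x..<y]) y"
  using assms
proof (induction "y - x" arbitrary: x)
  case (Suc d)
  then have "[x..<y] = x # [Suc x..<y]"
    by (simp add: upt_conv_Cons)
  with Suc show ?case by auto
qed auto

lemma map_labels_upt:
  "map_labels h (map (\<lambda>k. (k, Suc k, l k)) ks) = map (\<lambda>k. (k, Suc k, h k (Suc k) (l k))) ks"
  by (induction ks) auto

text \<open>Edge categories are posets, so a 2-cell is determined by its source and target. This
  reduces the retract identity on 2-cells to the one on 1-cells.\<close>

lemma map_pair_labels:
  assumes "map (\<lambda>k. (k, Suc k, f k)) ks = map_labels (\<lambda>_ _. fst) p"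
    and "map (\<lambda>k. (k, Suc k, g k)) ks = map_labels (\<lambda>_ _. snd) p"
  shows "map (\<lambda>k. (k, Suc k, (f k, g k))) ks = p"
  using assms
proof (induction ks arbitrary: p)
  case (Cons k ks)
  then show ?case by (cases p) auto
qed (auto simp: map_labels_def)

lemma is_path_theta_arr_src:
  "is_path {0..n} (theta_arr n q) x p y \<Longrightarrow>
    is_path {0..n} (theta_obj n q) x (map_labels (\<lambda>_ _. fst) p) y"
  by (erule is_path_map_labels) (auto simp: in_theta_arr_iff in_theta_obj_iff)

lemma is_path_theta_arr_tgt:
  "is_path {0..n} (theta_arr n q) x p y \<Longrightarrow>
    is_path {0..n} (theta_obj n q) x (map_labels (\<lambda>_ _. snd) p) y"
  by (erule is_path_map_labels) (auto simp: in_theta_arr_iff in_theta_obj_iff)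

section \<open>The section\<close>

lemma less_mult_le_trans: "a < x * N \<Longrightarrow> x \<le> y \<Longrightarrow> a < y * N" for a x y N :: nat
  by (meson less_le_trans mult_le_mono1)

definition corner :: "nat \<Rightarrow> nat \<Rightarrow> nat \<Rightarrow> bool list" where
  "corner N n x = map (\<lambda>a. a < x * N) [0..<n * N]"

lemma length_corner [simp]: "length (corner N n x) = n * N"
  by (simp add: corner_def)

lemma nth_corner [simp]: "a < n * N \<Longrightarrow> corner N n x ! a \<longleftrightarrow> a < x * N"
  by (simp add: corner_def)

lemma flips_corner:
  assumes "y \<le> n"
  shows "flips (corner N n x) (corner N n y) = {x * N..<y * N}"
proof -
  have "a < n * N" if "a < y * N" for a
    using that assms by (rule less_mult_le_trans)
  then show ?thesis by (auto simp: flips_def)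
qed

text \<open>Subtracting \<open>l\<close> makes the order grow with the label, since larger labels
  reverse less. When \<open>l \<le> q v < N\<close> and \<open>v = Suc u\<close>, the parameter
  stays inside the block starting at \<open>u * N\<close>.\<close>

fun path_order :: "nat \<Rightarrow> (nat \<Rightarrow> nat) \<Rightarrow> (nat \<times> nat \<times> nat) list \<Rightarrow> nat rel" where
  "path_order N q [] = {}"
| "path_order N q ((u, v, l) # p) =
    ordinal_sum (flip_order {u * N..<v * N} (u * N + q v - l)) (path_order N q p)"

lemma path_order_append:
  "path_order N q (p @ p') = ordinal_sum (path_order N q p) (path_order N q p')"
  by (induction N q p rule: path_order.induct) (auto simp: ordinal_sum_assoc)

text \<open>The bound \<open>x \<le> y\<close> is carried along because cutting the interval at
  \<open>Suc x * N\<close> needs \<open>Suc x \<le> y\<close>.\<close>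

lemma linear_order_on_path_order:
  assumes "is_path {0..n} (theta_obj n q) x p y"
  shows "x \<le> y \<and> linear_order_on {x * N..<y * N} (path_order N q p)"
  using assms
proof (induction p arbitrary: x)
  case Nil
  then show ?case by (auto simp: order_on_defs)
next
  case (Cons a p)
  then obtain l where a: "a = (x, Suc x, l)" and p: "is_path {0..n} (theta_obj n q) (Suc x) p y"
    by (cases a) (auto simp: in_theta_obj_iff)
  note IH = Cons.IH[OF p]
  have "x * N \<le> Suc x * N" "Suc x * N \<le> y * N"
    using IH by (auto intro: mult_le_mono1 simp del: mult_Suc)
  then have "{x * N..<y * N} = {x * N..<Suc x * N} \<union> {Suc x * N..<y * N}"
    by (simp only: ivl_disj_un_two)
  moreover have "linear_order_on ({x * N..<Suc x * N} \<union> {Suc x * N..<y * N}) (path_order N q (a # p))"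
    unfolding a path_order.simps
    using IH by (intro linear_order_on_ordinal_sum linear_order_on_flip_order) auto
  ultimately show ?case using IH by (simp del: mult_Suc)
qed

lemma shuffle_le_path_order:
  assumes "is_path {0..n} (theta_arr n q) x p y"
  shows "shuffle_le (path_order N q (map_labels (\<lambda>_ _. fst) p))
    (path_order N q (map_labels (\<lambda>_ _. snd) p))"
  using assms
proof (induction p arbitrary: x)
  case Nil
  then show ?case by (simp add: shuffle_le_refl)
next
  case (Cons a p)
  then obtain l m where a: "a = (x, Suc x, l, m)" "l \<le> m"
    and p: "is_path {0..n} (theta_arr n q) (Suc x) p y"
    by (cases a) (auto simp: in_theta_arr_iff)
  \<comment> \<open>Source and target path have the same ends, hence both orders live on the same
    interval, as \<open>shuffle_le_ordinal_sum\<close> demands.\<close>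
  have "Field (path_order N q (map_labels (\<lambda>_ _. fst) p)) =
      Field (path_order N q (map_labels (\<lambda>_ _. snd) p))"
    using linear_order_on_path_order[OF is_path_theta_arr_src[OF p], of N]
      linear_order_on_path_order[OF is_path_theta_arr_tgt[OF p], of N]
    by (auto simp: Field_linear_order)
  then show ?case
    using Cons.IH[OF p] a
    by (auto simp del: mult_Suc simp: Field_linear_order[OF linear_order_on_flip_order]
        intro!: shuffle_le_ordinal_sum shuffle_le_flip_order)
qed

section \<open>The section as a 2-functor\<close>

definition cube_section :: "nat \<Rightarrow> nat \<Rightarrow> (nat \<Rightarrow> nat) \<Rightarrow>
    (nat, (nat \<times> nat \<times> nat) list, (nat \<times> nat \<times> nat \<times> nat) list,
      bool list, nat rel, nat rel \<times> nat rel) two_map" where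
  "cube_section N n q =
    \<lparr>map0 = corner N n,
     map1 = (\<lambda>x y. path_order N q),
     map2 = (\<lambda>x y p. (path_order N q (map_labels (\<lambda>_ _. fst) p),
       path_order N q (map_labels (\<lambda>_ _. snd) p)))\<rparr>"

lemma path_order_in_gray_cells:
  assumes "is_path {0..n} (theta_obj n q) x p y"
  shows "path_order N q p \<in> gray_cells (n * N) (corner N n x) (corner N n y)"
proof -
  have "y \<le> n" using is_path_ends[OF assms] by simp
  then show ?thesis
    using linear_order_on_path_order[OF assms, of N]
    by (auto simp: gray_cells_def flips_corner dest: less_mult_le_trans)
qed

lemma strict_two_functor_cube_section:
  "strict_two_functor (theta n q) (gray_cube (n * N)) (cube_section N n q)"
proof -
  interpret K: strict_two_category "theta n q" by (rule strict_two_category_theta)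
  interpret L: strict_two_category "gray_cube (n * N)" by (rule strict_two_category_gray_cube)
  show ?thesis
  proof (intro strict_two_functor.intro strict_two_functor_axioms.intro K.strict_two_category_axioms
      L.strict_two_category_axioms)
    fix x y
    assume "x \<in> cells0 (theta n q)" "y \<in> cells0 (theta n q)"
    then show "cat_functor (hom (theta n q) x y)
      (hom (gray_cube (n * N)) (map0 (cube_section N n q) x) (map0 (cube_section N n q) y))
      (map1 (cube_section N n q) x y) (map2 (cube_section N n q) x y)"
      unfolding gray_cube_hom
      by (intro cat_functor_poset_catI K.hom_category category_gray_cells)
        (auto simp: cube_section_def intro: path_order_in_gray_cells shuffle_le_path_order)
  qed (auto simp: cube_section_def path_order_append)
qed

section \<open>The retraction\<close>

definition height :: "nat \<Rightarrow> bool list \<Rightarrow> nat" where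
  "height N e = (LEAST k. \<forall>a<length e. e ! a \<longrightarrow> a < k * N)"

text \<open>The right-hand side says that \<open>e\<close> lies below \<open>corner N n k\<close>:
  for strings of this length, \<open>height N\<close> is left adjoint to the corners. The later
  facts on heights and flips rest on this.\<close>

lemma height_le_iff:
  assumes "length e = n * N"
  shows "height N e \<le> k \<longleftrightarrow> (\<forall>a<n * N. e ! a \<longrightarrow> a < k * N)"
proof
  \<comment> \<open>The \<open>LEAST\<close> is over a nonempty set: \<open>n\<close> qualifies, all
    positions being below \<open>n * N\<close>.\<close>
  have "\<forall>a<length e. e ! a \<longrightarrow> a < height N e * N"
    unfolding height_def by (rule LeastI[of _ n]) (simp add: assms)
  then show "\<forall>a<n * N. e ! a \<longrightarrow> a < k * N" if "height N e \<le> k"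
    using assms that less_mult_le_trans by auto
next
  assume "\<forall>a<n * N. e ! a \<longrightarrow> a < k * N"
  then show "height N e \<le> k"
    unfolding height_def assms by (rule Least_le)
qed

lemma height_le: "length e = n * N \<Longrightarrow> height N e \<le> n"
  by (simp add: height_le_iff[of _ n])

lemma height_corner:
  assumes "x \<le> n" "0 < N"
  shows "height N (corner N n x) = x"
proof (rule antisym)
  show "height N (corner N n x) \<le> x"
    by (simp add: height_le_iff[of _ n])
  have *: "\<forall>a<n * N. a < x * N \<longrightarrow> a < height N (corner N n x) * N"
    using height_le_iff[of "corner N n x" n N "height N (corner N n x)"] by simp
  show "x \<le> height N (corner N n x)"
  proof (rule ccontr)
    assume "\<not> x \<le> height N (corner N n x)"
    \<comment> \<open>The position \<open>height N (corner N n x) * N\<close> then carries a one of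
      the corner, although all ones lie strictly below it.\<close>
    then have "height N (corner N n x) * N < x * N" "x * N \<le> n * N"
      using assms by simp_all
    then show False using * less_le_trans by blast
  qed
qed

lemma height_mono:
  assumes "length e = n * N" "length z = n * N" "r \<in> gray_cells (n * N) e z"
  shows "height N e \<le> height N z"
  using assms height_le_iff[OF assms(2), of "height N z"]
  by (auto simp: height_le_iff[OF assms(1)] gray_cells_def split: if_splits)

text \<open>From \<open>k * N\<close> on, \<open>z\<close> has a one and \<open>e\<close> has none.
  Hence \<open>first_from (k * N)\<close> is meaningful for every edge between the two
  heights.\<close>

lemma ex_flip:
  assumes "length e = n * N" "length z = n * N" "height N e \<le> k" "k < height N z"
  shows "\<exists>a\<in>flips e z. k * N \<le> a"
proof -
  obtain a where a: "a < n * N" "z ! a" "k * N \<le> a"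
    using assms(4) height_le_iff[OF assms(2), of k] by (auto simp: not_less)
  moreover have "\<not> e ! a"
    using assms(3) height_le_iff[OF assms(1), of k] a by (auto simp: not_less)
  ultimately show ?thesis using assms by (auto simp: flips_def)
qed

lemma flips_less_height:
  assumes "length e = n * N" "length z = n * N" "height N z \<le> k" "a \<in> flips e z"
  shows "a < k * N"
  using assms height_le_iff[OF assms(2), of k] by (auto simp: flips_def)

lemma finite_flips: "finite (flips e z)"
  by (simp add: flips_def)

text \<open>The subtraction truncates: the label is \<open>0\<close> when the first flip at or above position \<open>k * N\<close>
  lies beyond block \<open>k\<close>.\<close>

definition edge_label :: "nat \<Rightarrow> (nat \<Rightarrow> nat) \<Rightarrow> nat \<Rightarrow> nat rel \<Rightarrow> nat" where
  "edge_label N q k r = k * N + q (Suc k) - first_from (k * N) r"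

lemma edge_label_le:
  assumes "length e = n * N" "length z = n * N" "r \<in> gray_cells (n * N) e z"
    "height N e \<le> k" "k < height N z"
  shows "edge_label N q k r \<le> q (Suc k)"
proof -
  obtain a where "a \<in> flips e z" "k * N \<le> a"
    using ex_flip[OF assms(1,2,4,5)] by auto
  moreover have "linear_order_on (flips e z) r"
    using assms(3) by (auto simp: gray_cells_def split: if_splits)
  ultimately have "is_first (k * N) r (first_from (k * N) r)"
    by (auto intro: is_first_first_from finite_flips)
  then show ?thesis by (auto simp: edge_label_def is_first_def)
qed

text \<open>Two reversals cancel: going up in the shuffle order moves the first flip left, and the
  label decreases with its position.\<close>

lemma edge_label_mono:
  assumes "length e = n * N" "length z = n * N" "r \<in> gray_cells (n * N) e z"
    "s \<in> gray_cells (n * N) e z" "shuffle_le r s" "height N e \<le> k" "k < height N z"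
  shows "edge_label N q k r \<le> edge_label N q k s"
proof -
  obtain a where "a \<in> flips e z" "k * N \<le> a"
    using ex_flip[OF assms(1,2,6,7)] by auto
  moreover have "linear_order_on (flips e z) r" "linear_order_on (flips e z) s"
    using assms(3,4) by (auto simp: gray_cells_def split: if_splits)
  ultimately have "first_from (k * N) s \<le> first_from (k * N) r"
    using assms(5) by (auto intro: first_from_anti_mono finite_flips)
  then show ?thesis by (simp add: edge_label_def)
qed

text \<open>Below \<open>height N z\<close> the earlier factor \<open>r\<close> already has a flip
  from \<open>k * N\<close> on; from that height onwards it has none and \<open>s\<close> decides.
  This matches concatenation of paths at \<open>height N z\<close>.\<close>

lemma edge_label_ordinal_sum:
  assumes len: "length e = n * N" "length z = n * N" "length h = n * N"
    and rs: "r \<in> gray_cells (n * N) e z" "s \<in> gray_cells (n * N) z h"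
    and k: "height N e \<le> k" "k < height N h"
  shows "edge_label N q k (ordinal_sum r s) =
    (if k < height N z then edge_label N q k r else edge_label N q k s)"
proof -
  have lin: "linear_order_on (flips e z) r" "linear_order_on (flips z h) s"
    using rs by (auto simp: gray_cells_def split: if_splits)
  have disj: "flips e z \<inter> flips z h = {}"
    using len by (auto simp: flips_def)
  show ?thesis
  proof (cases "k < height N z")
    case True
    then obtain a where "a \<in> flips e z" "k * N \<le> a"
      using ex_flip[OF len(1,2) k(1)] by auto
    then show ?thesis
      using True first_from_ordinal_sum[OF lin disj finite_flips finite_flips, of a "k * N"]
      by (auto simp: edge_label_def)
  next
    case False
    then have "\<not> (\<exists>a\<in>flips e z. k * N \<le> a)"
      using flips_less_height[OF len(1,2), of k] by (auto simp: not_less not_le)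
    moreover obtain a where "a \<in> flips z h" "k * N \<le> a"
      using False ex_flip[OF len(2,3) _ k(2)] by (auto simp: not_less)
    ultimately show ?thesis
      using False first_from_ordinal_sum[OF lin disj finite_flips finite_flips, of a "k * N"]
      by (auto simp: edge_label_def)
  qed
qed

section \<open>The retraction as a 2-functor\<close>

definition cube_retraction :: "nat \<Rightarrow> (nat \<Rightarrow> nat) \<Rightarrow>
    (bool list, nat rel, nat rel \<times> nat rel,
      nat, (nat \<times> nat \<times> nat) list, (nat \<times> nat \<times> nat \<times> nat) list) two_map" where
  "cube_retraction N q =
    \<lparr>map0 = height N,
     map1 = (\<lambda>e z r. map (\<lambda>k. (k, Suc k, edge_label N q k r)) [height N e..<height N z]),
     map2 = (\<lambda>e z (r, s). map (\<lambda>k. (k, Suc k, edge_label N q k r, edge_label N q k s))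
       [height N e..<height N z])\<rparr>"

lemma map_upt_split:
  assumes "x \<le> y" "y \<le> z"
    and "\<And>k. x \<le> k \<Longrightarrow> k < z \<Longrightarrow> f k = (if k < y then g k else h k)"
  shows "map f [x..<z] = map g [x..<y] @ map h [y..<z]"
proof -
  have "[x..<z] = [x..<y] @ [y..<z]"
    using assms(1,2) by (metis le_add_diff_inverse upt_add_eq_append)
  then show ?thesis using assms by auto
qed

lemma strict_two_functor_cube_retraction:
  "strict_two_functor (gray_cube (n * N)) (theta n q) (cube_retraction N q)"
proof -
  interpret K: strict_two_category "gray_cube (n * N)" by (rule strict_two_category_gray_cube)
  interpret L: strict_two_category "theta n q" by (rule strict_two_category_theta)
  show ?thesis
  proof (intro strict_two_functor.intro strict_two_functor_axioms.intro K.strict_two_category_axioms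
      L.strict_two_category_axioms)
    fix x y :: "bool list"
    assume xy: "x \<in> cells0 (gray_cube (n * N))" "y \<in> cells0 (gray_cube (n * N))"
    then have len: "length x = n * N" "length y = n * N" by auto
    let ?R = "cube_retraction N q"
    let ?hx = "height N x" and ?hy = "height N y"
    interpret A: category "hom (gray_cube (n * N)) x y"
      by (rule K.hom_category[OF xy])
    interpret B: category "hom (theta n q) (map0 ?R x) (map0 ?R y)"
      using xy height_le by (intro L.hom_category) (auto simp: cube_retraction_def)
    show "cat_functor (hom (gray_cube (n * N)) x y) (hom (theta n q) (map0 ?R x) (map0 ?R y))
      (map1 ?R x y) (map2 ?R x y)"
    proof
      fix r
      assume "r \<in> cells1 (gray_cube (n * N)) x y"
      then have r: "r \<in> gray_cells (n * N) x y"
        by (simp add: gray_cube_hom poset_cat_def)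
      show "map1 ?R x y r \<in> cells1 (theta n q) (map0 ?R x) (map0 ?R y)"
        using height_mono[OF len r] height_le[OF len(1)] height_le[OF len(2)]
        by (auto simp: cube_retraction_def in_theta_obj_iff edge_label_le[OF len r]
            intro!: is_path_upt)
    next
      fix t
      assume "t \<in> cells2 (gray_cube (n * N)) x y"
      then obtain r s where t: "t = (r, s)" and r: "r \<in> gray_cells (n * N) x y"
        and s: "s \<in> gray_cells (n * N) x y" and le: "shuffle_le r s"
        by (auto simp add: gray_cube_hom poset_cat_def)
      show "map2 ?R x y t \<in> cells2 (theta n q) (map0 ?R x) (map0 ?R y)"
        using height_mono[OF len r] height_le[OF len(1)] height_le[OF len(2)]
        by (auto simp: t cube_retraction_def in_theta_arr_iff edge_label_le[OF len s]
            edge_label_mono[OF len r s le] intro!: is_path_upt)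
    qed (auto simp: cube_retraction_def gray_cube_hom poset_cat_def map_labels_upt
        zip_map_map zip_same_conv_map)
  next
    fix x y z r s
    assume "x \<in> cells0 (gray_cube (n * N))" "y \<in> cells0 (gray_cube (n * N))"
      "z \<in> cells0 (gray_cube (n * N))"
    then have len: "length x = n * N" "length y = n * N" "length z = n * N" by auto
    assume "r \<in> cells1 (gray_cube (n * N)) x y" "s \<in> cells1 (gray_cube (n * N)) y z"
    then have rs: "r \<in> gray_cells (n * N) x y" "s \<in> gray_cells (n * N) y z"
      by (auto simp add: gray_cube_hom poset_cat_def)
    show "map1 (cube_retraction N q) x z (hcmp1 (gray_cube (n * N)) x y z r s) =
      hcmp1 (theta n q) (map0 (cube_retraction N q) x) (map0 (cube_retraction N q) y)
        (map0 (cube_retraction N q) z) (map1 (cube_retraction N q) x y r)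
        (map1 (cube_retraction N q) y z s)"
      using height_mono[OF len(1,2) rs(1)] height_mono[OF len(2,3) rs(2)]
      by (auto simp: cube_retraction_def edge_label_ordinal_sum[OF len rs] intro!: map_upt_split)
  next
    fix x y z t t'
    assume "x \<in> cells0 (gray_cube (n * N))" "y \<in> cells0 (gray_cube (n * N))"
      "z \<in> cells0 (gray_cube (n * N))"
    then have len: "length x = n * N" "length y = n * N" "length z = n * N" by auto
    assume "t \<in> cells2 (gray_cube (n * N)) x y" "t' \<in> cells2 (gray_cube (n * N)) y z"
    then obtain r r' s s' where t: "t = (r, r')" "t' = (s, s')"
      and rs: "r \<in> gray_cells (n * N) x y" "s \<in> gray_cells (n * N) y z"
      and rs': "r' \<in> gray_cells (n * N) x y" "s' \<in> gray_cells (n * N) y z"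
      by (auto simp add: gray_cube_hom poset_cat_def)
    show "map2 (cube_retraction N q) x z (hcmp2 (gray_cube (n * N)) x y z t t') =
      hcmp2 (theta n q) (map0 (cube_retraction N q) x) (map0 (cube_retraction N q) y)
        (map0 (cube_retraction N q) z) (map2 (cube_retraction N q) x y t)
        (map2 (cube_retraction N q) y z t')"
      using height_mono[OF len(1,2) rs(1)] height_mono[OF len(2,3) rs(2)]
      by (auto simp: t cube_retraction_def edge_label_ordinal_sum[OF len rs]
          edge_label_ordinal_sum[OF len rs'] intro!: map_upt_split)
  qed (auto simp: cube_retraction_def height_le)
qed

text \<open>The retract identity on 1-cells. The head block returns its own label, and later labels
  ignore it because they look only at positions from \<open>Suc x * N\<close> on.\<close>

lemma edge_label_path_order:
  assumes "is_path {0..n} (theta_obj n q) x p y" "\<And>k. k \<le> n \<Longrightarrow> q k < N"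
  shows "map (\<lambda>k. (k, Suc k, edge_label N q k (path_order N q p))) [x..<y] = p"
  using assms(1)
proof (induction p arbitrary: x)
  case (Cons a p)
  then obtain l where a: "a = (x, Suc x, l)" and l: "l \<le> q (Suc x)" "Suc x \<le> n"
    and p: "is_path {0..n} (theta_obj n q) (Suc x) p y"
    by (cases a) (auto simp: in_theta_obj_iff)
  let ?f = "x * N + q (Suc x) - l"
  have lin: "Suc x \<le> y" "linear_order_on {Suc x * N..<y * N} (path_order N q p)"
    using linear_order_on_path_order[OF p] by auto
  \<comment> \<open>The offset \<open>q (Suc x) - l\<close> is less than \<open>N\<close>.\<close>
  have f: "?f \<in> {x * N..<Suc x * N}"
    using l assms(2)[of "Suc x"] by auto
  have disj: "{x * N..<Suc x * N} \<inter> {Suc x * N..<y * N} = {}"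
    by auto
  \<comment> \<open>Witness and bound stay open: they become \<open>?f\<close> and
    \<open>x * N\<close> for the head, and \<open>k * N\<close> twice for the later edges.\<close>
  note first = first_from_ordinal_sum[OF linear_order_on_flip_order lin(2) disj
      finite_atLeastLessThan finite_atLeastLessThan, of _ _ ?f]
  have "first_from (x * N) (path_order N q (a # p)) = ?f"
    using first[of ?f "x * N"] first_from_flip_order[OF f, of "x * N"] f
    by (auto simp: a simp del: mult_Suc)
  then have "edge_label N q x (path_order N q (a # p)) = l"
    using l by (simp add: edge_label_def)
  moreover have "edge_label N q k (path_order N q (a # p)) = edge_label N q k (path_order N q p)"
    if "k \<in> {Suc x..<y}" for k
  proof -
    \<comment> \<open>Positivity of \<open>N\<close> puts \<open>k * N\<close> itself into the tail
      interval, as a witness.\<close>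
    have "0 < N" using assms(2)[of 0] by simp
    with that have "k * N \<in> {Suc x * N..<y * N}"
      by (auto simp del: mult_Suc)
    moreover have "\<not> (\<exists>b\<in>{x * N..<Suc x * N}. k * N \<le> b)"
      using that less_mult_le_trans[of _ "Suc x" N k] by (auto simp del: mult_Suc simp: not_le)
    ultimately show ?thesis
      using first[of "k * N" "k * N"] by (auto simp: a edge_label_def simp del: mult_Suc)
  qed
  then have "map (\<lambda>k. (k, Suc k, edge_label N q k (path_order N q (a # p)))) [Suc x..<y] = p"
    \<comment> \<open>The induction hypothesis expands only the \<open>p\<close> on the right,
      leaving labels to be compared edge by edge.\<close>
    by (subst (2) Cons.IH[OF p, symmetric], intro map_cong) auto
  ultimately show ?case
    using lin(1) by (simp add: upt_conv_Cons a del: path_order.simps)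
qed auto

theorem theorem3p1:
  shows "\<forall>\<theta> \<in> Theta2_objects. \<exists>d :: nat. \<exists>S R.
    strict_two_functor \<theta> (gray_cube d) S \<and>
    strict_two_functor (gray_cube d) \<theta> R \<and>
    two_map_eq_on \<theta> (comp_two_map R S) id_two_map"
proof
  fix \<theta>
  assume "\<theta> \<in> Theta2_objects"
  then obtain n q where \<theta>: "\<theta> = theta n q"
    by (auto simp: Theta2_objects_def)
  \<comment> \<open>Starting at index \<open>0\<close> keeps the set nonempty when
    \<open>n = 0\<close>; the successor gives the strict bound on \<open>q\<close> and the
    positivity that \<open>height_corner\<close> requires.\<close>
  define N where "N = Suc (Max (q ` {0..n}))"
  have N: "q k < N" if "k \<le> n" for k
    using that by (simp add: N_def less_Suc_eq_le)
  have "two_map_eq_on (theta n q) (comp_two_map (cube_retraction N q) (cube_section N n q)) id_two_map"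
    unfolding two_map_eq_on_def
    by (auto simp: comp_two_map_def cube_retraction_def cube_section_def id_two_map_def N_def
        height_corner edge_label_path_order[OF _ N, unfolded N_def]
        intro!: map_pair_labels
        dest: is_path_theta_arr_src is_path_theta_arr_tgt)
  then show "\<exists>d S R. strict_two_functor \<theta> (gray_cube d) S \<and>
      strict_two_functor (gray_cube d) \<theta> R \<and> two_map_eq_on \<theta> (comp_two_map R S) id_two_map"
    unfolding \<theta> using strict_two_functor_cube_section strict_two_functor_cube_retraction by blast
qed

end
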